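(* Let $\mathscr{F}\subseteq\mathscr{P}(\omega)$ be a nonempty $\omega$-closed family. The semigroup $\boldsymbol{B}_{\omega}^{\mathscr{F}}$ is isomorphic to the bicyclic monoid $\mathscr{C}(p,q)$ if and only if $\mathscr{F}=\{F\}$ where $F$ is a nonempty inductive subset of $\omega$.
   Context: $\omega$ is the set of non-negative integers, $\mathscr{P}(\omega)$ its power set. A subset $A\subseteq\omega$ is inductive if $i\in A$ implies $i+1\in A$. For an integer $n$ and $F\subseteq\omega$ put $n+F=\{n+k\colon k\in F\}\subseteq\mathbb{Z}$ (empty if $F=\varnothing$). A family $\mathscr{F}\subseteq\mathscr{P}(\omega)$ is $\omega$-closed if $F_1\cap(-n+F_2)\in\mathscr{F}$ for all $n\in\omega$ and $F_1,F_2\in\mathscr{F}$. For an $\omega$-closed family $\mathscr{F}$, the set $\boldsymbol{B}_{\omega}\times\mathscr{F}=\omega\times\omega\times\mathscr{F}$ carries the semigroup operation $$(i_1,j_1,F_1)\cdot(i_2,j_2,F_2)=\begin{cases}(i_1-j_1+i_2,\,j_2,\,(j_1-i_2+F_1)\cap F_2), & j_1\leqslant i_2;\\ (i_1,\,j_1-i_2+j_2,\,F_1\cap(i_2-j_1+F_2)), & j_1\geqslant i_2.\end{cases}$$ If $\varnothing\notin\mathscr{F}$, then $\boldsymbol{B}_{\omega}^{\mathscr{F}}=(\boldsymbol{B}_{\omega}\times\mathscr{F},\cdot)$. If $\varnothing\in\mathscr{F}$, then $\boldsymbol{I}=\{(i,j,\varnothing)\colon i,j\in\omega\}$ is an ideal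 and $\boldsymbol{B}_{\omega}^{\mathscr{F}}$ is the Rees quotient $(\boldsymbol{B}_{\omega}\times\mathscr{F},\cdot)/\boldsymbol{I}$, in which all $(i,j,\varnothing)$ are identified to a single zero element $\boldsymbol{0}$. The bicyclic monoid $\mathscr{C}(p,q)$ is the monoid generated by $\{p,q\}$ subject to the single relation $pq=1$; equivalently, $\omega\times\omega$ with $(i_1,j_1)\cdot(i_2,j_2)=(i_1+i_2-\min\{j_1,i_2\},\,j_1+j_2-\min\{j_1,i_2\})$. *)

theory Defs
  imports "HOL-Algebra.Group"
begin

(* Semigroups are represented by the monoid records of HOL-Algebra. The library notions of
   homomorphism and isomorphism (hom, iso, \<cong>) refer to carrier and multiplication only,
   so the field one is irrelevant wherever no identity element is part of the structure. *)

definition quotient_monoid :: "('a, 'b) monoid_scheme \<Rightarrow> ('a \<times> 'a) set \<Rightarrow> 'a set monoid" where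
  "quotient_monoid S R =
     \<lparr>carrier = carrier S // R,
      mult = (\<lambda>X Y. \<Union>x\<in>X. \<Union>y\<in>Y. R `` {x \<otimes>\<^bsub>S\<^esub> y}),
      one = R `` {\<one>\<^bsub>S\<^esub>}\<rparr>"

definition rees_congruence :: "('a, 'b) monoid_scheme \<Rightarrow> 'a set \<Rightarrow> ('a \<times> 'a) set" where
  "rees_congruence S I =
     {(x, y) \<in> carrier S \<times> carrier S. x = y \<or> (x \<in> I \<and> y \<in> I)}"

definition rees_quotient :: "('a, 'b) monoid_scheme \<Rightarrow> 'a set \<Rightarrow> 'a set monoid" where
  "rees_quotient S I = quotient_monoid S (rees_congruence S I)"

definition inductive_subset :: "nat set \<Rightarrow> bool" where
  "inductive_subset A \<longleftrightarrow> (\<forall>i. i \<in> A \<longrightarrow> i + 1 \<in> A)"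

definition shift :: "int \<Rightarrow> nat set \<Rightarrow> int set" where
  "shift n F = {n + int k | k. k \<in> F}"

(* The part of n + F inside \<omega>. Translates are only ever intersected with subsets of \<omega>. *)
definition nat_shift :: "int \<Rightarrow> nat set \<Rightarrow> nat set" where
  "nat_shift n F = {m. int m \<in> shift n F}"

definition omega_closed :: "nat set set \<Rightarrow> bool" where
  "omega_closed \<F> \<longleftrightarrow>
     (\<forall>n::nat. \<forall>F1\<in>\<F>. \<forall>F2\<in>\<F>. F1 \<inter> nat_shift (- int n) F2 \<in> \<F>)"

(* The subtractions on nat are exact in their respective branches, and the two branches agree
   for j1 = i2. *)
fun B_mult :: "nat \<times> nat \<times> nat set \<Rightarrow> nat \<times> nat \<times> nat set \<Rightarrow> nat \<times> nat \<times> nat set" where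
  "B_mult (i1, j1, F1) (i2, j2, F2) =
     (if j1 \<le> i2
      then (i1 + i2 - j1, j2, nat_shift (int j1 - int i2) F1 \<inter> F2)
      else (i1, j1 + j2 - i2, F1 \<inter> nat_shift (int i2 - int j1) F2))"

definition B_times :: "nat set set \<Rightarrow> (nat \<times> nat \<times> nat set) monoid" where
  "B_times \<F> = \<lparr>carrier = UNIV \<times> UNIV \<times> \<F>, mult = B_mult, one = undefined\<rparr>"

definition empty_ideal :: "(nat \<times> nat \<times> nat set) set" where
  "empty_ideal = {(i, j, {}) | i j. True}"

(* If {} is not in the family, no element of empty_ideal lies in the carrier, the congruence is
   equality, and the quotient is B_times with every element replaced by its singleton
   (lemma B_omega_iso_B_times). *)
definition B_omega :: "nat set set \<Rightarrow> (nat \<times> nat \<times> nat set) set monoid" where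
  "B_omega \<F> = rees_quotient (B_times \<F>) empty_ideal"

datatype bicyclic_gen = P | Q

definition bicyclic_words :: "bicyclic_gen list monoid" where
  "bicyclic_words = \<lparr>carrier = UNIV, mult = (@), one = []\<rparr>"

(* The least monoid congruence on words with PQ = 1. *)
inductive_set bicyclic_congruence :: "(bicyclic_gen list \<times> bicyclic_gen list) set" where
  rel: "([P, Q], []) \<in> bicyclic_congruence"
| refl: "(u, u) \<in> bicyclic_congruence"
| sym: "(u, v) \<in> bicyclic_congruence \<Longrightarrow> (v, u) \<in> bicyclic_congruence"
| trans: "(u, v) \<in> bicyclic_congruence \<Longrightarrow> (v, w) \<in> bicyclic_congruence
    \<Longrightarrow> (u, w) \<in> bicyclic_congruence"
| append: "(u, u') \<in> bicyclic_congruence \<Longrightarrow> (v, v') \<in> bicyclic_congruence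
    \<Longrightarrow> (u @ v, u' @ v') \<in> bicyclic_congruence"

definition bicyclic_monoid :: "bicyclic_gen list set monoid" where
  "bicyclic_monoid = quotient_monoid bicyclic_words bicyclic_congruence"

definition bicyclic_pairs :: "(nat \<times> nat) monoid" where
  "bicyclic_pairs =
     \<lparr>carrier = UNIV,
      mult = (\<lambda>(i1, j1) (i2, j2). (i1 + i2 - min j1 i2, j1 + j2 - min j1 i2)),
      one = (0, 0)\<rparr>"

lemma equiv_rees_congruence: "equiv (carrier S) (rees_congruence S I)"
  unfolding rees_congruence_def by (rule equivI) (auto simp: refl_on_def sym_def trans_def)

lemma nat_shift_iff: "m \<in> nat_shift n F \<longleftrightarrow> (\<exists>k\<in>F. int m = n + int k)"
  by (auto simp: nat_shift_def shift_def)

lemma B_times_closed: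
  assumes "omega_closed \<F>" "x \<in> carrier (B_times \<F>)" "y \<in> carrier (B_times \<F>)"
  shows "x \<otimes>\<^bsub>B_times \<F>\<^esub> y \<in> carrier (B_times \<F>)"
proof -
  obtain i1 j1 F1 i2 j2 F2 where xy: "x = (i1, j1, F1)" "y = (i2, j2, F2)" "F1 \<in> \<F>" "F2 \<in> \<F>"
    using assms(2,3) by (auto simp: B_times_def)
  have *: "A \<inter> nat_shift (- int n) B \<in> \<F>" if "A \<in> \<F>" "B \<in> \<F>" for A B n
    using assms(1) that by (auto simp: omega_closed_def)
  have "F2 \<inter> nat_shift (int j1 - int i2) F1 \<in> \<F>" if "j1 \<le> i2"
    using *[of F2 F1 "i2 - j1"] xy that by (simp add: of_nat_diff)
  moreover have "F1 \<inter> nat_shift (int i2 - int j1) F2 \<in> \<F>" if "\<not> j1 \<le> i2"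
    using *[of F1 F2 "j1 - i2"] xy that by (simp add: of_nat_diff)
  ultimately show ?thesis
    using xy by (auto simp: B_times_def Int_commute)
qed

lemma B_mult_alt:
  "B_mult (i1, j1, F1) (i2, j2, F2) =
     (i1 + (i2 - j1), j2 + (j1 - i2), {m. m + (i2 - j1) \<in> F1 \<and> m + (j1 - i2) \<in> F2})"
proof -
  have "nat_shift (int j - int i) F = {m. m + (i - j) \<in> F}" if "j \<le> i" for i j F
  proof -
    have "int m = int j - int i + int k \<longleftrightarrow> k = m + (i - j)" for m k
      using that by linarith
    then show ?thesis by (auto simp: nat_shift_iff)
  qed
  then show ?thesis by auto
qed

lemma B_times_assoc:
  "(x \<otimes>\<^bsub>B_times \<F>\<^esub> y) \<otimes>\<^bsub>B_times \<F>\<^esub> z = x \<otimes>\<^bsub>B_times \<F>\<^esub> (y \<otimes>\<^bsub>B_times \<F>\<^esub> z)"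
proof -
  obtain a b A c d B e f C where xyz: "x = (a, b, A)" "y = (c, d, B)" "z = (e, f, C)"
    by (metis prod_cases3)
  have 1: "a + (c - b) + (e - (d + (b - c))) = a + (c + (e - d) - b)"
    by linarith
  have 2: "f + (d + (b - c) - e) = f + (d - e) + (b - (c + (e - d)))"
    by linarith
  have 3: "m + (e - (d + (b - c))) + (c - b) = m + (c + (e - d) - b)" for m
    by linarith
  have 4: "m + (e - (d + (b - c))) + (b - c) = m + (b - (c + (e - d))) + (e - d)" for m
    by linarith
  have 5: "m + (d + (b - c) - e) = m + (b - (c + (e - d))) + (d - e)" for m
    by linarith
  have "B_mult (B_mult x y) z = B_mult x (B_mult y z)"
    unfolding xyz B_mult_alt prod.inject mem_Collect_eq 1 2 3 4 5
    by (simp add: conj_assoc)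
  then show ?thesis by (simp add: B_times_def)
qed

lemma B_omega_iso_B_times:
  assumes "omega_closed \<F>" "{} \<notin> \<F>"
  shows "B_omega \<F> \<cong> B_times \<F>"
proof -
  let ?S = "B_times \<F>"
  let ?R = "rees_congruence ?S empty_ideal"
  have R: "?R = Id_on (carrier ?S)"
    using assms(2) by (auto simp: rees_congruence_def B_times_def empty_ideal_def)
  have "(\<lambda>x. {x}) \<in> iso ?S (B_omega \<F>)"
    unfolding iso_def hom_def B_omega_def rees_quotient_def quotient_monoid_def R
    using B_times_closed[OF assms(1)]
    by (auto simp: quotient_def bij_betw_def inj_on_def)
  moreover have "inv_into (carrier ?S) f \<in> iso (B_omega \<F>) ?S" if f: "f \<in> iso ?S (B_omega \<F>)" for f
  proof -
    let ?g = "inv_into (carrier ?S) f"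
    have bij: "bij_betw f (carrier ?S) (carrier (B_omega \<F>))"
      using f by (simp add: iso_def)
    have h: "f (x \<otimes>\<^bsub>?S\<^esub> y) = f x \<otimes>\<^bsub>B_omega \<F>\<^esub> f y" if "x \<in> carrier ?S" "y \<in> carrier ?S" for x y
      using f that by (simp add: iso_def hom_def)
    have g: "bij_betw ?g (carrier (B_omega \<F>)) (carrier ?S)"
      using bij by (rule bij_betw_inv_into)
    have "?g (x \<otimes>\<^bsub>B_omega \<F>\<^esub> y) = ?g x \<otimes>\<^bsub>?S\<^esub> ?g y"
      if "x \<in> carrier (B_omega \<F>)" "y \<in> carrier (B_omega \<F>)" for x y
    proof -
      have gx: "?g x \<in> carrier ?S" "?g y \<in> carrier ?S"
        using g that by (auto simp: bij_betw_def)
      have "f (?g x \<otimes>\<^bsub>?S\<^esub> ?g y) = x \<otimes>\<^bsub>B_omega \<F>\<^esub> y"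
        using h[OF gx] bij_betw_inv_into_right[OF bij] that by simp
      then show ?thesis
        using bij_betw_inv_into_left[OF bij B_times_closed[OF assms(1) gx]] by simp
    qed
    then show ?thesis
      using g by (auto simp: iso_def hom_def bij_betw_def)
  qed
  ultimately show ?thesis
    by (auto simp: is_iso_def)
qed

lemma equiv_bicyclic_congruence: "equiv UNIV bicyclic_congruence"
  by (rule equivI)
    (auto simp: refl_on_def sym_def trans_def intro: bicyclic_congruence.intros)

(* The pair (i, j) corresponds to the class of q^i p^j. *)
fun word_pair :: "bicyclic_gen list \<Rightarrow> nat \<times> nat" where
  "word_pair [] = (0, 0)"
| "word_pair (P # w) = (0, 1) \<otimes>\<^bsub>bicyclic_pairs\<^esub> word_pair w"
| "word_pair (Q # w) = (1, 0) \<otimes>\<^bsub>bicyclic_pairs\<^esub> word_pair w"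

lemma bicyclic_pairs_assoc:
  "(x \<otimes>\<^bsub>bicyclic_pairs\<^esub> y) \<otimes>\<^bsub>bicyclic_pairs\<^esub> z
   = x \<otimes>\<^bsub>bicyclic_pairs\<^esub> (y \<otimes>\<^bsub>bicyclic_pairs\<^esub> z)"
  by (cases x; cases y; cases z) (auto simp: bicyclic_pairs_def min_def)

lemma word_pair_append: "word_pair (u @ v) = word_pair u \<otimes>\<^bsub>bicyclic_pairs\<^esub> word_pair v"
proof (induction u rule: word_pair.induct)
  case 1
  show ?case by (cases "word_pair v") (simp add: bicyclic_pairs_def)
qed (simp_all add: bicyclic_pairs_assoc)

lemma word_pair_cong: "(u, v) \<in> bicyclic_congruence \<Longrightarrow> word_pair u = word_pair v"
  by (induction rule: bicyclic_congruence.induct)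
    (simp_all add: word_pair_append, simp add: bicyclic_pairs_def)

lemma bicyclic_normal_form:
  "word_pair w = (i, j) \<Longrightarrow> (w, replicate i Q @ replicate j P) \<in> bicyclic_congruence"
proof (induction w arbitrary: i j)
  case Nil
  then show ?case by (auto intro: bicyclic_congruence.refl)
next
  case (Cons x w)
  obtain k l where kl: "word_pair w = (k, l)" by fastforce
  have c: "(x # w, x # replicate k Q @ replicate l P) \<in> bicyclic_congruence"
    using bicyclic_congruence.append[OF bicyclic_congruence.refl[of "[x]"] Cons.IH[OF kl]] by simp
  show ?case
  proof (cases x)
    case Q
    then show ?thesis using c Cons.prems kl by (auto simp: bicyclic_pairs_def)
  next
    case P
    show ?thesis
    proof (cases k)
      case 0
      then show ?thesis using c P Cons.prems kl by (auto simp: bicyclic_pairs_def)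
    next
      case (Suc k')
      have "([P, Q] @ replicate k' Q @ replicate l P, [] @ replicate k' Q @ replicate l P)
          \<in> bicyclic_congruence"
        by (intro bicyclic_congruence.append bicyclic_congruence.rel bicyclic_congruence.refl)
      with c show ?thesis using P Suc Cons.prems kl
        by (auto simp: bicyclic_pairs_def intro: bicyclic_congruence.trans)
    qed
  qed
qed

lemma word_pair_iff: "(u, v) \<in> bicyclic_congruence \<longleftrightarrow> word_pair u = word_pair v"
  by (metis word_pair_cong bicyclic_normal_form bicyclic_congruence.sym bicyclic_congruence.trans
      surj_pair)

lemma word_pair_normal: "word_pair (replicate i Q @ replicate j P) = (i, j)"
proof (induction i)
  case 0
  show ?case by (induction j) (auto simp: bicyclic_pairs_def)
qed (simp add: bicyclic_pairs_def)

lemma bicyclic_pairs_carrier: "carrier bicyclic_pairs = UNIV"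
  by (simp add: bicyclic_pairs_def)

lemma bicyclic_pairs_iso_monoid: "bicyclic_pairs \<cong> bicyclic_monoid"
proof -
  let ?f = "\<lambda>x. {w. word_pair w = x}"
  have cls: "bicyclic_congruence `` {w} = ?f (word_pair w)" for w
    by (auto simp: word_pair_iff)
  have sur: "\<exists>w. word_pair w = x" for x
    using word_pair_normal by (metis surj_pair)
  have car: "carrier bicyclic_monoid = range ?f"
  proof -
    have "carrier bicyclic_monoid = (\<Union>w. {?f (word_pair w)})"
      by (simp add: bicyclic_monoid_def quotient_monoid_def bicyclic_words_def quotient_def cls)
    also have "\<dots> = range ?f"
    proof
      show "range ?f \<subseteq> (\<Union>w. {?f (word_pair w)})"
      proof
        fix X assume "X \<in> range ?f"
        then obtain x where "X = ?f x" by blast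
        moreover obtain w where "word_pair w = x" using sur by blast
        ultimately have "X = ?f (word_pair w)" by simp
        then show "X \<in> (\<Union>w. {?f (word_pair w)})" by blast
      qed
    qed blast
    finally show ?thesis .
  qed
  have inj: "inj ?f"
  proof (rule injI)
    fix x y assume eq: "?f x = ?f y"
    obtain w where w: "word_pair w = x" using sur by blast
    then have "w \<in> ?f y" using eq by blast
    then show "x = y" using w by simp
  qed
  have "?f (x \<otimes>\<^bsub>bicyclic_pairs\<^esub> y) = ?f x \<otimes>\<^bsub>bicyclic_monoid\<^esub> ?f y" for x y
  proof -
    obtain u v where "word_pair u = x" "word_pair v = y" using sur by metis
    then show ?thesis
      unfolding bicyclic_monoid_def quotient_monoid_def bicyclic_words_def
      by (auto simp: cls word_pair_append)
  qed
  then have "?f \<in> iso bicyclic_pairs bicyclic_monoid"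
    using inj car by (simp add: iso_def hom_def bij_betw_def Pi_def bicyclic_pairs_carrier)
  then show ?thesis by (auto simp: is_iso_def)
qed

end

theory Submission
  imports Defs
begin

text \<open>
  The forward direction compares two invariants of \<^term>\<open>B_omega \<F>\<close> with those of the bicyclic
  monoid. The bicyclic monoid has no zero, because left multiplication by \<open>q\<close> has no fixed point;
  hence the empty set cannot belong to the family, as all \<open>(i, j, {})\<close> collapse to a zero. Therefore
  the Rees congruence is equality and the isomorphism can be read on \<^term>\<open>B_times \<F>\<close> itself.
  Secondly, the bicyclic monoid is bisimple: any two idempotents \<open>q\<^sup>i p\<^sup>i\<close> and \<open>q\<^sup>j p\<^sup>j\<close> are the
  products \<open>x y\<close> and \<open>y x\<close> of a single pair of elements, namely \<open>x = q\<^sup>i p\<^sup>j\<close> and \<open>y = q\<^sup>j p\<^sup>i\<close>.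
  In \<^term>\<open>B_times \<F>\<close> the idempotents \<open>(0, 0, F)\<close>, for \<open>F\<close> in the family, are never linked in this
  way unless they are equal (lemma \<open>B_mult_linked_idempotents\<close>), so the family has only one member.
  Being \<open>\<omega>\<close>-closed, a singleton family \<open>{F}\<close> satisfies \<open>F \<inter> (-1 + F) = F\<close>, which says that
  \<open>F\<close> is inductive.

  Conversely, if \<open>F\<close> is inductive, translating \<open>F\<close> downwards only enlarges it, so the third
  component of every product is \<open>F\<close> again, and the first two multiply as in the bicyclic monoid.
\<close>

lemma is_iso_sym:
  assumes iso: "S \<cong> T"
    and closed: "\<And>x y. x \<in> carrier S \<Longrightarrow> y \<in> carrier S \<Longrightarrow> x \<otimes>\<^bsub>S\<^esub> y \<in> carrier S"
  shows "T \<cong> S"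
proof -
  obtain f where f: "f \<in> hom S T" "bij_betw f (carrier S) (carrier T)"
    using iso by (auto simp: is_iso_def iso_def)
  let ?g = "inv_into (carrier S) f"
  have g: "bij_betw ?g (carrier T) (carrier S)"
    using f(2) by (rule bij_betw_inv_into)
  have "?g (x \<otimes>\<^bsub>T\<^esub> y) = ?g x \<otimes>\<^bsub>S\<^esub> ?g y" if "x \<in> carrier T" "y \<in> carrier T" for x y
  proof -
    have gx: "?g x \<in> carrier S" "?g y \<in> carrier S"
      using g that by (auto simp: bij_betw_def)
    have "f (?g x \<otimes>\<^bsub>S\<^esub> ?g y) = x \<otimes>\<^bsub>T\<^esub> y"
      using hom_mult[OF f(1) gx] bij_betw_inv_into_right[OF f(2)] that by simp
    then show ?thesis
      using bij_betw_inv_into_left[OF f(2) closed[OF gx]] by simp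
  qed
  then have "?g \<in> iso T S"
    using g by (auto simp: iso_def hom_def bij_betw_def)
  then show ?thesis by (auto simp: is_iso_def)
qed

text \<open>Replacing a factor by a different representative of its class happens only inside \<open>I\<close>; as
  \<open>I\<close> is a two-sided ideal, both products then lie in \<open>I\<close>, so they are congruent.\<close>

lemma rees_projection_epi:
  assumes closed: "\<And>x y. x \<in> carrier S \<Longrightarrow> y \<in> carrier S \<Longrightarrow> x \<otimes>\<^bsub>S\<^esub> y \<in> carrier S"
    and left: "\<And>x y. x \<in> carrier S \<Longrightarrow> y \<in> carrier S \<Longrightarrow> y \<in> I \<Longrightarrow> x \<otimes>\<^bsub>S\<^esub> y \<in> I"
    and right: "\<And>x y. x \<in> carrier S \<Longrightarrow> y \<in> carrier S \<Longrightarrow> x \<in> I \<Longrightarrow> x \<otimes>\<^bsub>S\<^esub> y \<in> I"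
  shows "(\<lambda>x. rees_congruence S I `` {x}) \<in> epi S (rees_quotient S I)"
proof -
  let ?R = "rees_congruence S I"
  have "congruent2 ?R ?R (\<lambda>x y. ?R `` {x \<otimes>\<^bsub>S\<^esub> y})"
  proof (rule congruent2I')
    fix x x' y y' assume "(x, x') \<in> ?R" "(y, y') \<in> ?R"
    then have "(x \<otimes>\<^bsub>S\<^esub> y, x' \<otimes>\<^bsub>S\<^esub> y') \<in> ?R"
      using closed left right by (auto simp: rees_congruence_def)
    then show "?R `` {x \<otimes>\<^bsub>S\<^esub> y} = ?R `` {x' \<otimes>\<^bsub>S\<^esub> y'}"
      by (rule equiv_class_eq[OF equiv_rees_congruence])
  qed
  then have "?R `` {x \<otimes>\<^bsub>S\<^esub> y} = ?R `` {x} \<otimes>\<^bsub>rees_quotient S I\<^esub> ?R `` {y}"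
    if "x \<in> carrier S" "y \<in> carrier S" for x y
    unfolding rees_quotient_def quotient_monoid_def monoid.simps
    using that by (intro UN_equiv_class2[OF equiv_rees_congruence equiv_rees_congruence, symmetric])
  then show ?thesis
    by (auto simp: epi_def hom_def rees_quotient_def quotient_monoid_def quotient_def)
qed

lemma B_omega_projection_epi:
  assumes "omega_closed \<F>"
  shows "(\<lambda>x. rees_congruence (B_times \<F>) empty_ideal `` {x}) \<in> epi (B_times \<F>) (B_omega \<F>)"
  unfolding B_omega_def
proof (rule rees_projection_epi)
  fix x y :: "nat \<times> nat \<times> nat set"
  show "x \<otimes>\<^bsub>B_times \<F>\<^esub> y \<in> empty_ideal" if "y \<in> empty_ideal"
    using that by (cases x) (auto simp: B_times_def empty_ideal_def B_mult_alt simp del: B_mult.simps)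
  show "x \<otimes>\<^bsub>B_times \<F>\<^esub> y \<in> empty_ideal" if "x \<in> empty_ideal"
    using that by (cases y) (auto simp: B_times_def empty_ideal_def B_mult_alt simp del: B_mult.simps)
qed (rule B_times_closed[OF assms])

text \<open>Vanishing of the outer coordinates of \<open>x y\<close> forces \<open>x = (0, b, A)\<close> and \<open>y = (b, 0, B)\<close>.
  Then \<open>y x = (b, b, A \<inter> B)\<close>, so that \<open>b = 0\<close> and both products are \<open>(0, 0, A \<inter> B)\<close>.\<close>

lemma B_mult_linked_idempotents:
  assumes "B_mult x y = (0, 0, F1)" and "B_mult y x = (0, 0, F2)"
  shows "F1 = F2"
  using assms
  by (cases x; cases y) (auto simp: B_mult_alt simp del: B_mult.simps)

text \<open>Both parts work with the composite \<open>g\<close> of the Rees projection and the isomorphism, because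
  \<^term>\<open>B_times \<F>\<close> has concrete products: absence of a zero gives \<open>F1 \<noteq> {}\<close>, so that \<open>g\<close> is
  injective, and then linked idempotents can be pulled back along \<open>g\<close>.\<close>

lemma bicyclic_imp_singleton:
  assumes closed: "omega_closed \<F>" and iso: "B_omega \<F> \<cong> bicyclic_pairs"
    and F1: "F1 \<in> \<F>" and F2: "F2 \<in> \<F>"
  shows "F1 \<noteq> {}" and "F1 = F2"
proof -
  let ?S = "B_times \<F>" and ?p = "\<lambda>x. rees_congruence (B_times \<F>) empty_ideal `` {x}"
  obtain f where f: "f \<in> iso (B_omega \<F>) bicyclic_pairs"
    using iso by (auto simp: is_iso_def)
  define g where "g = f \<circ> ?p"
  have p: "?p \<in> hom ?S (B_omega \<F>)" "?p ` carrier ?S = carrier (B_omega \<F>)"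
    using B_omega_projection_epi[OF closed] by (auto simp: epi_def)
  have f_bij: "bij_betw f (carrier (B_omega \<F>)) UNIV"
    using f by (simp add: iso_def bicyclic_pairs_carrier)
  have "g \<in> hom ?S bicyclic_pairs"
    unfolding g_def using p(1) f by (auto simp: iso_def intro: hom_compose)
  then have g_mult: "g (x \<otimes>\<^bsub>?S\<^esub> y) = g x \<otimes>\<^bsub>bicyclic_pairs\<^esub> g y"
    if "x \<in> carrier ?S" "y \<in> carrier ?S" for x y
    using that by (rule hom_mult)
  have g_surj: "\<exists>x\<in>carrier ?S. g x = u" for u
  proof -
    have "g ` carrier ?S = UNIV"
      using f_bij by (simp only: g_def image_comp[symmetric] p(2) bij_betw_def)
    then show ?thesis by (metis UNIV_I imageE)
  qed
  have nonempty: "{} \<notin> \<F>"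
  proof
    assume empty: "{} \<in> \<F>"
    let ?z = "(0, 0, {}) :: nat \<times> nat \<times> nat set"
    have z: "?z \<in> carrier ?S" using empty by (simp add: B_times_def)
    \<comment> \<open>The pair \<open>(1, 0)\<close> is \<open>q\<close>, whose left multiplication raises the first coordinate.\<close>
    obtain x where x: "x \<in> carrier ?S" "g x = (1, 0)" using g_surj by blast
    have "x \<otimes>\<^bsub>?S\<^esub> ?z \<in> empty_ideal"
      by (cases x) (auto simp: B_times_def empty_ideal_def B_mult_alt simp del: B_mult.simps)
    then have "(x \<otimes>\<^bsub>?S\<^esub> ?z, ?z) \<in> rees_congruence ?S empty_ideal"
      using B_times_closed[OF closed x(1) z] z by (auto simp: rees_congruence_def empty_ideal_def)
    then have "?p (x \<otimes>\<^bsub>?S\<^esub> ?z) = ?p ?z"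
      by (rule equiv_class_eq[OF equiv_rees_congruence])
    then have "(1, 0) \<otimes>\<^bsub>bicyclic_pairs\<^esub> g ?z = g ?z"
      using g_mult[OF x(1) z] x(2) by (simp add: g_def)
    then show False by (cases "g ?z") (simp add: bicyclic_pairs_def)
  qed
  with F1 show "F1 \<noteq> {}" by blast
  have p_inj: "inj_on ?p (carrier ?S)"
  proof (rule inj_onI)
    fix x y assume xy: "x \<in> carrier ?S" "y \<in> carrier ?S" "?p x = ?p y"
    have "(x, y) \<in> rees_congruence ?S empty_ideal"
      using xy(3) equiv_rees_congruence xy(2) by (rule eq_equiv_class)
    then show "x = y"
      using nonempty by (auto simp: rees_congruence_def empty_ideal_def B_times_def)
  qed
  have g_inj: "inj_on g (carrier ?S)"
    unfolding g_def using p_inj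
  proof (rule comp_inj_on)
    show "inj_on f (?p ` carrier ?S)"
      unfolding p(2) using f_bij by (rule bij_betw_imp_inj_on)
  qed
  let ?e = "\<lambda>F. (0, 0, F) :: nat \<times> nat \<times> nat set"
  have e: "?e F1 \<in> carrier ?S" "?e F2 \<in> carrier ?S" using F1 F2 by (simp_all add: B_times_def)
  have idem: "\<exists>i. g (?e F) = (i, i)" if "?e F \<in> carrier ?S" for F
  proof -
    have "?e F \<otimes>\<^bsub>?S\<^esub> ?e F = ?e F"
      by (simp add: B_times_def B_mult_alt del: B_mult.simps)
    then have "g (?e F) \<otimes>\<^bsub>bicyclic_pairs\<^esub> g (?e F) = g (?e F)"
      using g_mult[OF that that] by simp
    then show ?thesis
      by (cases "g (?e F)") (auto simp: bicyclic_pairs_def min_def split: if_splits)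
  qed
  obtain i j where ij: "g (?e F1) = (i, i)" "g (?e F2) = (j, j)"
    using idem e by metis
  obtain x y where xy: "x \<in> carrier ?S" "g x = (i, j)" "y \<in> carrier ?S" "g y = (j, i)"
    using g_surj by metis
  have "g (x \<otimes>\<^bsub>?S\<^esub> y) = g (?e F1)" "g (y \<otimes>\<^bsub>?S\<^esub> x) = g (?e F2)"
    using g_mult xy ij by (simp_all add: bicyclic_pairs_def)
  then have "x \<otimes>\<^bsub>?S\<^esub> y = ?e F1" "y \<otimes>\<^bsub>?S\<^esub> x = ?e F2"
    using xy(1,3) e by (auto intro!: inj_onD[OF g_inj] B_times_closed[OF closed])
  then show "F1 = F2"
    by (intro B_mult_linked_idempotents[of x y]) (simp_all add: B_times_def)
qed

lemma omega_closed_singleton: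
  assumes "omega_closed {F}"
  shows "inductive_subset F"
proof -
  have "F \<inter> nat_shift (- int 1) F = F"
    using assms unfolding omega_closed_def by blast
  then have "F \<subseteq> nat_shift (- int 1) F" by blast
  moreover have "i + 1 \<in> F" if i: "i \<in> nat_shift (- int 1) F" for i
  proof -
    obtain k where "k \<in> F" "int i = - int 1 + int k" using i unfolding nat_shift_iff by blast
    moreover from this(2) have "k = i + 1" by linarith
    ultimately show ?thesis by simp
  qed
  ultimately show ?thesis by (auto simp: inductive_subset_def)
qed

lemma inductive_subset_add:
  assumes "inductive_subset F" and "m \<in> F"
  shows "m + n \<in> F"
  using assms by (induction n) (auto simp: inductive_subset_def)

lemma B_times_inductive_iso:
  assumes "inductive_subset F"
  shows "B_times {F} \<cong> bicyclic_pairs"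
proof -
  let ?f = "\<lambda>(i, j, F). (i, j) :: nat \<times> nat"
  have "{m. m + (k - l) \<in> F \<and> m + (l - k) \<in> F} = F" for k l :: nat
  proof -
    have "k - l = 0 \<or> l - k = 0" by linarith
    then show ?thesis
    proof
      assume "k - l = 0"
      then show ?thesis using inductive_subset_add[OF assms, of _ "l - k"] by (simp only: add_0_right) blast
    next
      assume "l - k = 0"
      then show ?thesis using inductive_subset_add[OF assms, of _ "k - l"] by (simp only: add_0_right) blast
    qed
  qed
  then have "?f (x \<otimes>\<^bsub>B_times {F}\<^esub> y) = ?f x \<otimes>\<^bsub>bicyclic_pairs\<^esub> ?f y" for x y
    by (cases x; cases y)
      (auto simp: B_times_def bicyclic_pairs_def B_mult_alt min_def simp del: B_mult.simps)
  moreover have "bij_betw ?f (carrier (B_times {F})) (carrier bicyclic_pairs)"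
    by (auto simp: bij_betw_def inj_on_def B_times_def bicyclic_pairs_def image_def)
  ultimately have "?f \<in> iso (B_times {F}) bicyclic_pairs"
    by (auto simp: iso_def hom_def bicyclic_pairs_carrier)
  then show ?thesis by (auto simp: is_iso_def)
qed

theorem mainTheorem9:
  fixes \<F> :: "nat set set"
  assumes "\<F> \<noteq> {}" and "omega_closed \<F>"
  shows "B_omega \<F> \<cong> bicyclic_monoid \<longleftrightarrow>
    (\<exists>F. \<F> = {F} \<and> F \<noteq> {} \<and> inductive_subset F)"
proof
  assume "B_omega \<F> \<cong> bicyclic_monoid"
  moreover have "bicyclic_monoid \<cong> bicyclic_pairs"
    using bicyclic_pairs_iso_monoid by (rule is_iso_sym) (simp add: bicyclic_pairs_carrier)
  ultimately have iso: "B_omega \<F> \<cong> bicyclic_pairs"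
    by (rule iso_trans)
  obtain F where F: "F \<in> \<F>" using assms(1) by blast
  have "\<F> = {F}" using bicyclic_imp_singleton(2)[OF assms(2) iso F] F by blast
  moreover have "F \<noteq> {}" using bicyclic_imp_singleton(1)[OF assms(2) iso F F] .
  ultimately show "\<exists>F. \<F> = {F} \<and> F \<noteq> {} \<and> inductive_subset F"
    using omega_closed_singleton assms(2) by blast
next
  assume "\<exists>F. \<F> = {F} \<and> F \<noteq> {} \<and> inductive_subset F"
  then obtain F where F: "\<F> = {F}" "F \<noteq> {}" "inductive_subset F" by blast
  have "B_omega \<F> \<cong> B_times \<F>"
    using B_omega_iso_B_times[OF assms(2)] F by simp
  also have "B_times \<F> \<cong> bicyclic_pairs"
    using B_times_inductive_iso F by simp
  also note bicyclic_pairs_iso_monoid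
  finally show "B_omega \<F> \<cong> bicyclic_monoid" .
qed

end
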